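(* If a consecution $X \vdash Y$ is provable in the display calculus $\mathrm{DL}_{\mathrm{CBI}}$, then it is cut-free provable.
   Context: CBI-formulas: $F ::= P \mid \top \mid \bot \mid \neg F \mid F\wedge F \mid F \vee F \mid F \to F \mid \top^* \mid \bot^* \mid \mathord{\sim} F \mid F * F \mid F \mathbin{\vee^*} F \mid F \mathrel{-\!\!*} F$, $P$ ranging over a countably infinite set of propositional variables. Structures: $X ::= F \mid \emptyset_a \mid \sharp X \mid X ; X \mid \emptyset_m \mid \flat X \mid X , X$ (with $\emptyset_a$, $\emptyset_m$ two distinct structural constants). A consecution is $X \vdash Y$ for structures $X,Y$. Display postulates (each line lists consecutions any two of which are interderivable, in both directions): (1) $X;Y\vdash Z$, $X \vdash \sharp Y ; Z$, $Y;X\vdash Z$; (2) $X\vdash Y;Z$, $X;\sharp Y\vdash Z$, $X\vdash Z;Y$; (3) $X\vdash Y$, $\sharp Y\vdash \sharp X$, $\sharp\sharp X\vdash Y$; and (4)–(6) the same three with $;$ replaced by $,$ and $\sharp$ by $\flat$. Two consecutions are display-equivalent if one is derivable from the other using only display postulates. Rules of $\mathrm{DL}_{\mathrm{CBI}}$ (premises / conclusion): (Id) axiom $P\vdash P$ for propositional variables $P$; (Cut) $X\vdash F$ and $F\vdash Y$ / $X\vdash Y$; ($\equiv_D$) $X'\vdash Y'$ / $X\vdash Y$ whenever these are display-equivalent. Logical: $\emptyset_a\vdash X$ / $\top\vdash X$; axiom $\emptyset_a\vdash\top$; $\emptyset_m\vdash X$ / $\top^*\vdash X$; axiom $\emptyset_m\vdash\top^*$;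 axiom $\bot\vdash\emptyset_a$; $X\vdash\emptyset_a$ / $X\vdash\bot$; axiom $\bot^*\vdash\emptyset_m$; $X\vdash\emptyset_m$ / $X\vdash\bot^*$; $\sharp F\vdash X$ / $\neg F\vdash X$; $X\vdash\sharp F$ / $X\vdash\neg F$; $\flat F\vdash X$ / $\mathord{\sim}F\vdash X$; $X\vdash \flat F$ / $X\vdash\mathord{\sim}F$; $F;G\vdash X$ / $F\wedge G\vdash X$; $X\vdash F$, $Y\vdash G$ / $X;Y\vdash F\wedge G$; $F,G\vdash X$ / $F*G\vdash X$; $X\vdash F$, $Y\vdash G$ / $X,Y\vdash F*G$; $F\vdash X$, $G\vdash Y$ / $F\vee G\vdash X;Y$; $X\vdash F;G$ / $X\vdash F\vee G$; $F\vdash X$, $G\vdash Y$ / $F\mathbin{\vee^*}G\vdash X,Y$; $X\vdash F,G$ / $X\vdash F\mathbin{\vee^*}G$; $X\vdash F$, $G\vdash Y$ / $F\to G\vdash \sharp X;Y$; $X;F\vdash G$ / $X\vdash F\to G$; $X\vdash F$, $G\vdash Y$ / $F\mathrel{-\!\!*}G\vdash\flat X,Y$; $X,F\vdash G$ / $X\vdash F\mathrel{-\!\!*}G$. Structural (the first eight bidirectional): $W;(X;Y)\vdash Z$ ⇔ $(W;X);Y\vdash Z$; $W\vdash(X;Y);Z$ ⇔ $W\vdash X;(Y;Z)$; the same two with $,$ in place of $;$; $\emptyset_a;X\vdash Y$ ⇔ $X\vdash Y$; $X\vdash Y;\emptyset_a$ ⇔ $X\vdash Y$; $\emptyset_m,X\vdash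 Y$ ⇔ $X\vdash Y$; $X\vdash Y,\emptyset_m$ ⇔ $X\vdash Y$; weakening $X\vdash Z$ / $X;Y\vdash Z$ and $X\vdash Z$ / $X\vdash Y;Z$; contraction $X;X\vdash Z$ / $X\vdash Z$ and $X\vdash Z;Z$ / $X\vdash Z$. A proof is a finite derivation tree using these rules; it is cut-free if it contains no instance of (Cut). *)

theory Defs
  imports Main
begin

text \<open>Propositional variables are natural numbers. Connectives of formulas are set in bold, or carry
  a star in the multiplicative case, to keep them apart from those of HOL; likewise the two
  structural connectives, semicolon and comma.\<close>

datatype cbi_formula =
    Var nat
  | Top  (\<open>\<^bold>\<top>\<close>)
  | Bot  (\<open>\<^bold>\<bottom>\<close>)
  | Neg cbi_formula  (\<open>\<^bold>\<not> _\<close> [90] 90)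
  | And cbi_formula cbi_formula  (infixr \<open>\<^bold>\<and>\<close> 85)
  | Or cbi_formula cbi_formula  (infixr \<open>\<^bold>\<or>\<close> 84)
  | Imp cbi_formula cbi_formula  (infixr \<open>\<^bold>\<rightarrow>\<close> 83)
  | MTop  (\<open>\<top>\<^sup>*\<close>)
  | MBot  (\<open>\<bottom>\<^sup>*\<close>)
  | MNeg cbi_formula  (\<open>\<^bold>\<sim> _\<close> [90] 90)
  | MAnd cbi_formula cbi_formula  (infixr \<open>\<^bold>*\<close> 85)
  | MOr cbi_formula cbi_formula  (infixr \<open>\<or>\<^sup>*\<close> 84)
  | MImp cbi_formula cbi_formula  (infixr \<open>-\<^bold>*\<close> 83)

datatype cbi_structure =
    Fml cbi_formula  (\<open>\<langle>_\<rangle>\<close>)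
  | AEmpty  (\<open>\<emptyset>\<^sub>a\<close>)
  | Sharp cbi_structure  (\<open>\<sharp> _\<close> [80] 80)
  | Semi cbi_structure cbi_structure  (infix \<open>\<^bold>;\<close> 75)
  | MEmpty  (\<open>\<emptyset>\<^sub>m\<close>)
  | Flat cbi_structure  (\<open>\<flat> _\<close> [80] 80)
  | Comma cbi_structure cbi_structure  (infix \<open>\<^bold>,\<close> 75)

datatype consecution = Consecution cbi_structure cbi_structure  (infix \<open>\<turnstile>\<close> 60)

inductive display_line :: "consecution set \<Rightarrow> bool" where
  "display_line {X \<^bold>; Y \<turnstile> Z, X \<turnstile> \<sharp> Y \<^bold>; Z, Y \<^bold>; X \<turnstile> Z}"
| "display_line {X \<turnstile> Y \<^bold>; Z, X \<^bold>; \<sharp> Y \<turnstile> Z, X \<turnstile> Z \<^bold>; Y}"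
| "display_line {X \<turnstile> Y, \<sharp> Y \<turnstile> \<sharp> X, \<sharp> (\<sharp> X) \<turnstile> Y}"
| "display_line {X \<^bold>, Y \<turnstile> Z, X \<turnstile> \<flat> Y \<^bold>, Z, Y \<^bold>, X \<turnstile> Z}"
| "display_line {X \<turnstile> Y \<^bold>, Z, X \<^bold>, \<flat> Y \<turnstile> Z, X \<turnstile> Z \<^bold>, Y}"
| "display_line {X \<turnstile> Y, \<flat> Y \<turnstile> \<flat> X, \<flat> (\<flat> X) \<turnstile> Y}"

definition display_postulate :: "consecution \<Rightarrow> consecution \<Rightarrow> bool" where
  "display_postulate c d \<longleftrightarrow> (\<exists>L. display_line L \<and> c \<in> L \<and> d \<in> L)"

text \<open>Display postulates have a single premise, so a derivation that uses only them is a finite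
  chain; as they are symmetric, so is the closure.\<close>

definition display_equiv :: "consecution \<Rightarrow> consecution \<Rightarrow> bool"  (infix \<open>\<equiv>\<^sub>D\<close> 50) where
  "c \<equiv>\<^sub>D d \<longleftrightarrow> display_postulate\<^sup>*\<^sup>* c d"

datatype rule_name =
    Id | Cut | Display
  | TopL | TopR | MTopL | MTopR | BotL | BotR | MBotL | MBotR
  | NegL | NegR | MNegL | MNegR
  | AndL | AndR | MAndL | MAndR | OrL | OrR | MOrL | MOrR | ImpL | ImpR | MImpL | MImpR
  | AAssocL | AAssocR | MAssocL | MAssocR | AUnitL | AUnitR | MUnitL | MUnitR
  | WkL | WkR | CtrL | CtrR

text \<open>\<open>rule_instance r ps c\<close>: from the premises \<open>ps\<close> the rule \<open>r\<close> infers \<open>c\<close>. A bidirectional rule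
  has two clauses under one name.\<close>

inductive rule_instance :: "rule_name \<Rightarrow> consecution list \<Rightarrow> consecution \<Rightarrow> bool" where
  "rule_instance Id [] (\<langle>Var p\<rangle> \<turnstile> \<langle>Var p\<rangle>)"
| "rule_instance Cut [X \<turnstile> \<langle>F\<rangle>, \<langle>F\<rangle> \<turnstile> Y] (X \<turnstile> Y)"
| "X' \<turnstile> Y' \<equiv>\<^sub>D X \<turnstile> Y \<Longrightarrow> rule_instance Display [X' \<turnstile> Y'] (X \<turnstile> Y)"

| "rule_instance TopL [\<emptyset>\<^sub>a \<turnstile> X] (\<langle>\<^bold>\<top>\<rangle> \<turnstile> X)"
| "rule_instance TopR [] (\<emptyset>\<^sub>a \<turnstile> \<langle>\<^bold>\<top>\<rangle>)"
| "rule_instance MTopL [\<emptyset>\<^sub>m \<turnstile> X] (\<langle>\<top>\<^sup>*\<rangle> \<turnstile> X)"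
| "rule_instance MTopR [] (\<emptyset>\<^sub>m \<turnstile> \<langle>\<top>\<^sup>*\<rangle>)"
| "rule_instance BotL [] (\<langle>\<^bold>\<bottom>\<rangle> \<turnstile> \<emptyset>\<^sub>a)"
| "rule_instance BotR [X \<turnstile> \<emptyset>\<^sub>a] (X \<turnstile> \<langle>\<^bold>\<bottom>\<rangle>)"
| "rule_instance MBotL [] (\<langle>\<bottom>\<^sup>*\<rangle> \<turnstile> \<emptyset>\<^sub>m)"
| "rule_instance MBotR [X \<turnstile> \<emptyset>\<^sub>m] (X \<turnstile> \<langle>\<bottom>\<^sup>*\<rangle>)"
| "rule_instance NegL [\<sharp> \<langle>F\<rangle> \<turnstile> X] (\<langle>\<^bold>\<not> F\<rangle> \<turnstile> X)"
| "rule_instance NegR [X \<turnstile> \<sharp> \<langle>F\<rangle>] (X \<turnstile> \<langle>\<^bold>\<not> F\<rangle>)"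
| "rule_instance MNegL [\<flat> \<langle>F\<rangle> \<turnstile> X] (\<langle>\<^bold>\<sim> F\<rangle> \<turnstile> X)"
| "rule_instance MNegR [X \<turnstile> \<flat> \<langle>F\<rangle>] (X \<turnstile> \<langle>\<^bold>\<sim> F\<rangle>)"
| "rule_instance AndL [\<langle>F\<rangle> \<^bold>; \<langle>G\<rangle> \<turnstile> X] (\<langle>F \<^bold>\<and> G\<rangle> \<turnstile> X)"
| "rule_instance AndR [X \<turnstile> \<langle>F\<rangle>, Y \<turnstile> \<langle>G\<rangle>] (X \<^bold>; Y \<turnstile> \<langle>F \<^bold>\<and> G\<rangle>)"
| "rule_instance MAndL [\<langle>F\<rangle> \<^bold>, \<langle>G\<rangle> \<turnstile> X] (\<langle>F \<^bold>* G\<rangle> \<turnstile> X)"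
| "rule_instance MAndR [X \<turnstile> \<langle>F\<rangle>, Y \<turnstile> \<langle>G\<rangle>] (X \<^bold>, Y \<turnstile> \<langle>F \<^bold>* G\<rangle>)"
| "rule_instance OrL [\<langle>F\<rangle> \<turnstile> X, \<langle>G\<rangle> \<turnstile> Y] (\<langle>F \<^bold>\<or> G\<rangle> \<turnstile> X \<^bold>; Y)"
| "rule_instance OrR [X \<turnstile> \<langle>F\<rangle> \<^bold>; \<langle>G\<rangle>] (X \<turnstile> \<langle>F \<^bold>\<or> G\<rangle>)"
| "rule_instance MOrL [\<langle>F\<rangle> \<turnstile> X, \<langle>G\<rangle> \<turnstile> Y] (\<langle>F \<or>\<^sup>* G\<rangle> \<turnstile> X \<^bold>, Y)"
| "rule_instance MOrR [X \<turnstile> \<langle>F\<rangle> \<^bold>, \<langle>G\<rangle>] (X \<turnstile> \<langle>F \<or>\<^sup>* G\<rangle>)"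
| "rule_instance ImpL [X \<turnstile> \<langle>F\<rangle>, \<langle>G\<rangle> \<turnstile> Y] (\<langle>F \<^bold>\<rightarrow> G\<rangle> \<turnstile> \<sharp> X \<^bold>; Y)"
| "rule_instance ImpR [X \<^bold>; \<langle>F\<rangle> \<turnstile> \<langle>G\<rangle>] (X \<turnstile> \<langle>F \<^bold>\<rightarrow> G\<rangle>)"
| "rule_instance MImpL [X \<turnstile> \<langle>F\<rangle>, \<langle>G\<rangle> \<turnstile> Y] (\<langle>F -\<^bold>* G\<rangle> \<turnstile> \<flat> X \<^bold>, Y)"
| "rule_instance MImpR [X \<^bold>, \<langle>F\<rangle> \<turnstile> \<langle>G\<rangle>] (X \<turnstile> \<langle>F -\<^bold>* G\<rangle>)"

| "rule_instance AAssocL [W \<^bold>; (X \<^bold>; Y) \<turnstile> Z] ((W \<^bold>; X) \<^bold>; Y \<turnstile> Z)"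
| "rule_instance AAssocL [(W \<^bold>; X) \<^bold>; Y \<turnstile> Z] (W \<^bold>; (X \<^bold>; Y) \<turnstile> Z)"
| "rule_instance AAssocR [W \<turnstile> (X \<^bold>; Y) \<^bold>; Z] (W \<turnstile> X \<^bold>; (Y \<^bold>; Z))"
| "rule_instance AAssocR [W \<turnstile> X \<^bold>; (Y \<^bold>; Z)] (W \<turnstile> (X \<^bold>; Y) \<^bold>; Z)"
| "rule_instance MAssocL [W \<^bold>, (X \<^bold>, Y) \<turnstile> Z] ((W \<^bold>, X) \<^bold>, Y \<turnstile> Z)"
| "rule_instance MAssocL [(W \<^bold>, X) \<^bold>, Y \<turnstile> Z] (W \<^bold>, (X \<^bold>, Y) \<turnstile> Z)"
| "rule_instance MAssocR [W \<turnstile> (X \<^bold>, Y) \<^bold>, Z] (W \<turnstile> X \<^bold>, (Y \<^bold>, Z))"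
| "rule_instance MAssocR [W \<turnstile> X \<^bold>, (Y \<^bold>, Z)] (W \<turnstile> (X \<^bold>, Y) \<^bold>, Z)"
| "rule_instance AUnitL [\<emptyset>\<^sub>a \<^bold>; X \<turnstile> Y] (X \<turnstile> Y)"
| "rule_instance AUnitL [X \<turnstile> Y] (\<emptyset>\<^sub>a \<^bold>; X \<turnstile> Y)"
| "rule_instance AUnitR [X \<turnstile> Y \<^bold>; \<emptyset>\<^sub>a] (X \<turnstile> Y)"
| "rule_instance AUnitR [X \<turnstile> Y] (X \<turnstile> Y \<^bold>; \<emptyset>\<^sub>a)"
| "rule_instance MUnitL [\<emptyset>\<^sub>m \<^bold>, X \<turnstile> Y] (X \<turnstile> Y)"
| "rule_instance MUnitL [X \<turnstile> Y] (\<emptyset>\<^sub>m \<^bold>, X \<turnstile> Y)"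
| "rule_instance MUnitR [X \<turnstile> Y \<^bold>, \<emptyset>\<^sub>m] (X \<turnstile> Y)"
| "rule_instance MUnitR [X \<turnstile> Y] (X \<turnstile> Y \<^bold>, \<emptyset>\<^sub>m)"
| "rule_instance WkL [X \<turnstile> Z] (X \<^bold>; Y \<turnstile> Z)"
| "rule_instance WkR [X \<turnstile> Z] (X \<turnstile> Y \<^bold>; Z)"
| "rule_instance CtrL [X \<^bold>; X \<turnstile> Z] (X \<turnstile> Z)"
| "rule_instance CtrR [X \<turnstile> Z \<^bold>; Z] (X \<turnstile> Z)"

text \<open>Every node of a derivation tree carries the rule applied there and the consecution inferred.\<close>

datatype deriv = Infer rule_name "deriv list" (concl: consecution)

fun is_proof :: "deriv \<Rightarrow> bool" where
  "is_proof (Infer r ds c) \<longleftrightarrow> rule_instance r (map concl ds) c \<and> (\<forall>d \<in> set ds. is_proof d)"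

fun cut_free :: "deriv \<Rightarrow> bool" where
  "cut_free (Infer r ds c) \<longleftrightarrow> r \<noteq> Cut \<and> (\<forall>d \<in> set ds. cut_free d)"

definition provable :: "consecution \<Rightarrow> bool" where
  "provable c \<longleftrightarrow> (\<exists>d. is_proof d \<and> concl d = c)"

definition cut_free_provable :: "consecution \<Rightarrow> bool" where
  "cut_free_provable c \<longleftrightarrow> (\<exists>d. is_proof d \<and> cut_free d \<and> concl d = c)"

end

theory Submission
  imports Defs
begin

text \<open>Call \<open>x\<close> and \<open>y\<close> orthogonal if \<open>x \<turnstile> y\<close> is cut-free provable; this gives a Galois connection
  between sets of antecedent and sets of consequent structures. Interpret every formula by a pair
  of mutually polar sets, extend this to structures pointwise, and call a consecution valid if the
  interpretations of its two sides are orthogonal. Cut is sound because the two sets of a formula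
  are mutually polar; the display postulates and the structural rules are sound because they can be
  applied pointwise. By induction every formula belongs to both of its own sets, hence every
  structure to its own interpretations, so a valid consecution is cut-free provable.\<close>

section \<open>Closure of cut-free provability under the rules other than Cut\<close>

lemma cut_free_provable_rule:
  assumes "rule_instance r ps c" "r \<noteq> Cut" "\<forall>p\<in>set ps. cut_free_provable p"
  shows "cut_free_provable c"
proof -
  from assms(3) obtain f where f: "\<forall>p\<in>set ps. is_proof (f p) \<and> cut_free (f p) \<and> concl (f p) = p"
    unfolding cut_free_provable_def by metis
  then have "map concl (map f ps) = ps"
    by (simp add: map_idI)
  with f assms(1,2) have "is_proof (Infer r (map f ps) c) \<and> cut_free (Infer r (map f ps) c)"
    by auto
  then show ?thesis
    unfolding cut_free_provable_def by (metis deriv.sel)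
qed

text \<open>The selected introductions are Id and all logical rules; the two skipped in between are
  Cut and Display.\<close>

lemmas cut_free_provable_logical =
  rule_instance.intros(1,4-27)[THEN cut_free_provable_rule, simplified]

lemma cut_free_provable_bidirectional:
  "cut_free_provable ((W \<^bold>; X) \<^bold>; Y \<turnstile> Z) \<longleftrightarrow> cut_free_provable (W \<^bold>; (X \<^bold>; Y) \<turnstile> Z)"
  "cut_free_provable (W \<turnstile> (X \<^bold>; Y) \<^bold>; Z) \<longleftrightarrow> cut_free_provable (W \<turnstile> X \<^bold>; (Y \<^bold>; Z))"
  "cut_free_provable ((W \<^bold>, X) \<^bold>, Y \<turnstile> Z) \<longleftrightarrow> cut_free_provable (W \<^bold>, (X \<^bold>, Y) \<turnstile> Z)"
  "cut_free_provable (W \<turnstile> (X \<^bold>, Y) \<^bold>, Z) \<longleftrightarrow> cut_free_provable (W \<turnstile> X \<^bold>, (Y \<^bold>, Z))"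
  "cut_free_provable (\<emptyset>\<^sub>a \<^bold>; X \<turnstile> Y) \<longleftrightarrow> cut_free_provable (X \<turnstile> Y)"
  "cut_free_provable (X \<turnstile> Y \<^bold>; \<emptyset>\<^sub>a) \<longleftrightarrow> cut_free_provable (X \<turnstile> Y)"
  "cut_free_provable (\<emptyset>\<^sub>m \<^bold>, X \<turnstile> Y) \<longleftrightarrow> cut_free_provable (X \<turnstile> Y)"
  "cut_free_provable (X \<turnstile> Y \<^bold>, \<emptyset>\<^sub>m) \<longleftrightarrow> cut_free_provable (X \<turnstile> Y)"
  using rule_instance.intros(28-43)[THEN cut_free_provable_rule, simplified] by metis+

lemmas cut_free_provable_weakening =
  rule_instance.intros(44,45)[THEN cut_free_provable_rule, simplified]

lemmas cut_free_provable_contraction =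
  rule_instance.intros(46,47)[THEN cut_free_provable_rule, simplified]

lemma cut_free_provable_display_postulate:
  assumes "display_postulate c d" "cut_free_provable c"
  shows "cut_free_provable d"
proof -
  obtain X Y X' Y' where "c = (X \<turnstile> Y)" "d = (X' \<turnstile> Y')"
    by (metis consecution.exhaust)
  with assms show ?thesis
    using cut_free_provable_rule[OF rule_instance.intros(3)[of X Y X' Y']]
    by (auto simp: display_equiv_def)
qed

lemma cut_free_provable_display_line:
  assumes "display_line L" "c \<in> L" "d \<in> L"
  shows "cut_free_provable c \<longleftrightarrow> cut_free_provable d"
  using assms cut_free_provable_display_postulate unfolding display_postulate_def by blast

text \<open>Each postulate line has three members, so two equivalences anchored at a common member
  capture it.\<close>

lemma cut_free_provable_display:
  "cut_free_provable (X \<turnstile> \<sharp> Y \<^bold>; Z) \<longleftrightarrow> cut_free_provable (X \<^bold>; Y \<turnstile> Z)"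
  "cut_free_provable (Y \<^bold>; X \<turnstile> Z) \<longleftrightarrow> cut_free_provable (X \<^bold>; Y \<turnstile> Z)"
  "cut_free_provable (X \<^bold>; \<sharp> Y \<turnstile> Z) \<longleftrightarrow> cut_free_provable (X \<turnstile> Y \<^bold>; Z)"
  "cut_free_provable (X \<turnstile> Z \<^bold>; Y) \<longleftrightarrow> cut_free_provable (X \<turnstile> Y \<^bold>; Z)"
  "cut_free_provable (\<sharp> Y \<turnstile> \<sharp> X) \<longleftrightarrow> cut_free_provable (X \<turnstile> Y)"
  "cut_free_provable (\<sharp> (\<sharp> X) \<turnstile> Y) \<longleftrightarrow> cut_free_provable (X \<turnstile> Y)"
  "cut_free_provable (X \<turnstile> \<flat> Y \<^bold>, Z) \<longleftrightarrow> cut_free_provable (X \<^bold>, Y \<turnstile> Z)"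
  "cut_free_provable (Y \<^bold>, X \<turnstile> Z) \<longleftrightarrow> cut_free_provable (X \<^bold>, Y \<turnstile> Z)"
  "cut_free_provable (X \<^bold>, \<flat> Y \<turnstile> Z) \<longleftrightarrow> cut_free_provable (X \<turnstile> Y \<^bold>, Z)"
  "cut_free_provable (X \<turnstile> Z \<^bold>, Y) \<longleftrightarrow> cut_free_provable (X \<turnstile> Y \<^bold>, Z)"
  "cut_free_provable (\<flat> Y \<turnstile> \<flat> X) \<longleftrightarrow> cut_free_provable (X \<turnstile> Y)"
  "cut_free_provable (\<flat> (\<flat> X) \<turnstile> Y) \<longleftrightarrow> cut_free_provable (X \<turnstile> Y)"
             apply (rule cut_free_provable_display_line[OF display_line.intros(1)]; blast)
            apply (rule cut_free_provable_display_line[OF display_line.intros(1)]; blast)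
           apply (rule cut_free_provable_display_line[OF display_line.intros(2)]; blast)
          apply (rule cut_free_provable_display_line[OF display_line.intros(2)]; blast)
         apply (rule cut_free_provable_display_line[OF display_line.intros(3)]; blast)
        apply (rule cut_free_provable_display_line[OF display_line.intros(3)]; blast)
       apply (rule cut_free_provable_display_line[OF display_line.intros(4)]; blast)
      apply (rule cut_free_provable_display_line[OF display_line.intros(4)]; blast)
     apply (rule cut_free_provable_display_line[OF display_line.intros(5)]; blast)
    apply (rule cut_free_provable_display_line[OF display_line.intros(5)]; blast)
   apply (rule cut_free_provable_display_line[OF display_line.intros(6)]; blast)
  apply (rule cut_free_provable_display_line[OF display_line.intros(6)]; blast)
  done

section \<open>Polar sets and the interpretation of formulas and structures\<close>

definition left_polar :: "cbi_structure set \<Rightarrow> cbi_structure set" where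
  "left_polar B = {x. \<forall>y\<in>B. cut_free_provable (x \<turnstile> y)}"

definition right_polar :: "cbi_structure set \<Rightarrow> cbi_structure set" where
  "right_polar A = {y. \<forall>x\<in>A. cut_free_provable (x \<turnstile> y)}"

lemma right_left_right_polar: "right_polar (left_polar (right_polar A)) = right_polar A"
  unfolding left_polar_def right_polar_def by blast

lemma left_right_left_polar: "left_polar (right_polar (left_polar B)) = left_polar B"
  unfolding left_polar_def right_polar_def by blast

text \<open>The consequent set is derived as the right polar. Generators copy the conclusions of
  \<open>TopR\<close>, \<open>AndR\<close> and their multiplicative analogues on the antecedent
  side, hence two polars; those for bottom, disjunction, implication and negation are consequents,
  so one left polar is enough.\<close>

fun ante_fml :: "cbi_formula \<Rightarrow> cbi_structure set" where
  "ante_fml (Var p) = left_polar {\<langle>Var p\<rangle>}"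
| "ante_fml \<^bold>\<top> = left_polar (right_polar {\<emptyset>\<^sub>a})"
| "ante_fml \<^bold>\<bottom> = left_polar {\<emptyset>\<^sub>a}"
| "ante_fml (\<^bold>\<not> F) = left_polar (Sharp ` ante_fml F)"
| "ante_fml (F \<^bold>\<and> G) = left_polar (right_polar (case_prod (\<^bold>;) ` (ante_fml F \<times> ante_fml G)))"
| "ante_fml (F \<^bold>\<or> G) =
     left_polar (case_prod (\<^bold>;) ` (right_polar (ante_fml F) \<times> right_polar (ante_fml G)))"
| "ante_fml (F \<^bold>\<rightarrow> G) =
     left_polar ((\<lambda>(x, y). \<sharp> x \<^bold>; y) ` (ante_fml F \<times> right_polar (ante_fml G)))"
| "ante_fml \<top>\<^sup>* = left_polar (right_polar {\<emptyset>\<^sub>m})"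
| "ante_fml \<bottom>\<^sup>* = left_polar {\<emptyset>\<^sub>m}"
| "ante_fml (\<^bold>\<sim> F) = left_polar (Flat ` ante_fml F)"
| "ante_fml (F \<^bold>* G) = left_polar (right_polar (case_prod (\<^bold>,) ` (ante_fml F \<times> ante_fml G)))"
| "ante_fml (F \<or>\<^sup>* G) =
     left_polar (case_prod (\<^bold>,) ` (right_polar (ante_fml F) \<times> right_polar (ante_fml G)))"
| "ante_fml (F -\<^bold>* G) =
     left_polar ((\<lambda>(x, y). \<flat> x \<^bold>, y) ` (ante_fml F \<times> right_polar (ante_fml G)))"

abbreviation cons_fml :: "cbi_formula \<Rightarrow> cbi_structure set" where
  "cons_fml F \<equiv> right_polar (ante_fml F)"

text \<open>Every clause of \<open>ante_fml\<close> is a left polar, and left polars are fixed by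
  the double polar.\<close>

lemma ante_fml_closed: "left_polar (cons_fml F) = ante_fml F"
  by (cases F) (simp_all add: left_right_left_polar)

lemma ante_fml_iff: "x \<in> ante_fml F \<longleftrightarrow> (\<forall>y\<in>cons_fml F. cut_free_provable (x \<turnstile> y))"
  using ante_fml_closed[of F] unfolding left_polar_def by blast

lemma cons_fml_iff: "y \<in> cons_fml F \<longleftrightarrow> (\<forall>x\<in>ante_fml F. cut_free_provable (x \<turnstile> y))"
  unfolding right_polar_def by blast

text \<open>The recursion is mutual because \<sharp> and \<flat> exchange the sides. No polar
  closure is taken at structural connectives, so members keep the shape on which display postulates
  and structural rules act.\<close>

fun ante :: "cbi_structure \<Rightarrow> cbi_structure set" and cons :: "cbi_structure \<Rightarrow> cbi_structure set" where
  "ante \<langle>F\<rangle> = ante_fml F"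
| "ante \<emptyset>\<^sub>a = {\<emptyset>\<^sub>a}"
| "ante (\<sharp> X) = Sharp ` cons X"
| "ante (X \<^bold>; Y) = case_prod (\<^bold>;) ` (ante X \<times> ante Y)"
| "ante \<emptyset>\<^sub>m = {\<emptyset>\<^sub>m}"
| "ante (\<flat> X) = Flat ` cons X"
| "ante (X \<^bold>, Y) = case_prod (\<^bold>,) ` (ante X \<times> ante Y)"
| "cons \<langle>F\<rangle> = cons_fml F"
| "cons \<emptyset>\<^sub>a = {\<emptyset>\<^sub>a}"
| "cons (\<sharp> X) = Sharp ` ante X"
| "cons (X \<^bold>; Y) = case_prod (\<^bold>;) ` (cons X \<times> cons Y)"
| "cons \<emptyset>\<^sub>m = {\<emptyset>\<^sub>m}"
| "cons (\<flat> X) = Flat ` ante X"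
| "cons (X \<^bold>, Y) = case_prod (\<^bold>,) ` (cons X \<times> cons Y)"

fun valid :: "consecution \<Rightarrow> bool" where
  "valid (X \<turnstile> Y) \<longleftrightarrow> (\<forall>x\<in>ante X. \<forall>y\<in>cons Y. cut_free_provable (x \<turnstile> y))"

text \<open>For each connective, one logical rule tests the formula against arbitrary generators.
  The opposite rule is used at the generator built from the subformulas themselves, which is one by
  the induction hypothesis.\<close>

lemma formula_in_own_interpretation: "\<langle>F\<rangle> \<in> ante_fml F \<and> \<langle>F\<rangle> \<in> cons_fml F"
proof (induction F)
  case (Neg F)
  \<comment> \<open>Contraposing \<open>x \<turnstile> \<langle>F\<rangle>\<close> gives the premise
    of \<open>NegL\<close> at each generator \<open>\<sharp> x\<close>.\<close>
  then have "\<forall>x\<in>ante_fml F. cut_free_provable (\<sharp> \<langle>F\<rangle> \<turnstile> \<sharp> x)"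
    by (simp add: cut_free_provable_display cons_fml_iff)
  with Neg show ?case
    by (auto simp: left_polar_def right_polar_def intro!: cut_free_provable_logical)
next
  case (MNeg F)
  then have "\<forall>x\<in>ante_fml F. cut_free_provable (\<flat> \<langle>F\<rangle> \<turnstile> \<flat> x)"
    by (simp add: cut_free_provable_display cons_fml_iff)
  with MNeg show ?case
    by (auto simp: left_polar_def right_polar_def intro!: cut_free_provable_logical)
next
  case (Imp F G)
  \<comment> \<open>The assumption is the premise of \<open>ImpR\<close> in displayed form; its
    right side is itself a generator.\<close>
  have "cut_free_provable (x \<turnstile> \<langle>F \<^bold>\<rightarrow> G\<rangle>)" if "cut_free_provable (x \<turnstile> \<sharp> \<langle>F\<rangle> \<^bold>; \<langle>G\<rangle>)" for x
    using that cut_free_provable_logical by (simp add: cut_free_provable_display(1))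
  with Imp show ?case
    by (auto simp: left_polar_def right_polar_def intro: cut_free_provable_logical)
next
  case (MImp F G)
  have "cut_free_provable (x \<turnstile> \<langle>F -\<^bold>* G\<rangle>)" if "cut_free_provable (x \<turnstile> \<flat> \<langle>F\<rangle> \<^bold>, \<langle>G\<rangle>)" for x
    using that cut_free_provable_logical by (simp add: cut_free_provable_display(7))
  with MImp show ?case
    by (auto simp: left_polar_def right_polar_def intro: cut_free_provable_logical)
next
  case (And F G)
  then show ?case
    by (simp add: right_left_right_polar)
      (auto simp: left_polar_def right_polar_def intro!: cut_free_provable_logical)
next
  case (MAnd F G)
  then show ?case
    by (simp add: right_left_right_polar)
      (auto simp: left_polar_def right_polar_def intro!: cut_free_provable_logical)
qed (auto simp: left_polar_def right_polar_def intro!: cut_free_provable_logical)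

lemma structure_in_own_interpretation: "X \<in> ante X \<and> X \<in> cons X"
  by (induction X) (auto simp: formula_in_own_interpretation)

lemma valid_imp_cut_free_provable: "valid (X \<turnstile> Y) \<Longrightarrow> cut_free_provable (X \<turnstile> Y)"
  using structure_in_own_interpretation by simp

section \<open>Soundness of the display postulates and of all rules, Cut included\<close>

lemma valid_display:
  "valid (X \<turnstile> \<sharp> Y \<^bold>; Z) \<longleftrightarrow> valid (X \<^bold>; Y \<turnstile> Z)"
  "valid (Y \<^bold>; X \<turnstile> Z) \<longleftrightarrow> valid (X \<^bold>; Y \<turnstile> Z)"
  "valid (X \<^bold>; \<sharp> Y \<turnstile> Z) \<longleftrightarrow> valid (X \<turnstile> Y \<^bold>; Z)"
  "valid (X \<turnstile> Z \<^bold>; Y) \<longleftrightarrow> valid (X \<turnstile> Y \<^bold>; Z)"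
  "valid (\<sharp> Y \<turnstile> \<sharp> X) \<longleftrightarrow> valid (X \<turnstile> Y)"
  "valid (\<sharp> (\<sharp> X) \<turnstile> Y) \<longleftrightarrow> valid (X \<turnstile> Y)"
  "valid (X \<turnstile> \<flat> Y \<^bold>, Z) \<longleftrightarrow> valid (X \<^bold>, Y \<turnstile> Z)"
  "valid (Y \<^bold>, X \<turnstile> Z) \<longleftrightarrow> valid (X \<^bold>, Y \<turnstile> Z)"
  "valid (X \<^bold>, \<flat> Y \<turnstile> Z) \<longleftrightarrow> valid (X \<turnstile> Y \<^bold>, Z)"
  "valid (X \<turnstile> Z \<^bold>, Y) \<longleftrightarrow> valid (X \<turnstile> Y \<^bold>, Z)"
  "valid (\<flat> Y \<turnstile> \<flat> X) \<longleftrightarrow> valid (X \<turnstile> Y)"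
  "valid (\<flat> (\<flat> X) \<turnstile> Y) \<longleftrightarrow> valid (X \<turnstile> Y)"
  \<comment> \<open>Both sides quantify over the same component sets, so each goal reduces to the
    cut-free equivalence at individual members.\<close>
  apply (auto simp: cut_free_provable_display(1))[1]
  apply (simp; metis cut_free_provable_display(2))[1]
  apply (auto simp: cut_free_provable_display(3))[1]
  apply (simp; metis cut_free_provable_display(4))[1]
  apply (auto simp: cut_free_provable_display(5))[1]
  apply (auto simp: cut_free_provable_display(6))[1]
  apply (auto simp: cut_free_provable_display(7))[1]
  apply (simp; metis cut_free_provable_display(8))[1]
  apply (auto simp: cut_free_provable_display(9))[1]
  apply (simp; metis cut_free_provable_display(10))[1]
  apply (auto simp: cut_free_provable_display(11))[1]
  apply (auto simp: cut_free_provable_display(12))[1]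
  done

lemma valid_display_postulate:
  assumes "display_postulate c d" "valid c"
  shows "valid d"
proof -
  from assms(1) obtain L where L: "display_line L" "c \<in> L" "d \<in> L"
    unfolding display_postulate_def by blast
  from L(1) have "valid c \<longleftrightarrow> valid d"
  proof cases
    case (1 X Y Z)
    with L(2,3) show ?thesis
      using valid_display(1)[of X Y Z] valid_display(2)[of Y X Z]
      by (auto simp del: valid.simps)
  next
    case (2 X Y Z)
    with L(2,3) show ?thesis
      using valid_display(3)[of X Y Z] valid_display(4)[of X Z Y]
      by (auto simp del: valid.simps)
  next
    case (3 X Y)
    with L(2,3) show ?thesis
      using valid_display(5)[of Y X] valid_display(6)[of X Y]
      by (auto simp del: valid.simps)
  next
    case (4 X Y Z)
    with L(2,3) show ?thesis
      using valid_display(7)[of X Y Z] valid_display(8)[of Y X Z]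
      by (auto simp del: valid.simps)
  next
    case (5 X Y Z)
    with L(2,3) show ?thesis
      using valid_display(9)[of X Y Z] valid_display(10)[of X Z Y]
      by (auto simp del: valid.simps)
  next
    case (6 X Y)
    with L(2,3) show ?thesis
      using valid_display(11)[of Y X] valid_display(12)[of X Y]
      by (auto simp del: valid.simps)
  qed
  with assms(2) show ?thesis
    by simp
qed

lemma valid_display_equiv:
  assumes "c \<equiv>\<^sub>D d" "valid c"
  shows "valid d"
  using assms(1) unfolding display_equiv_def
  by (induction rule: rtranclp_induct) (blast intro: assms(2) valid_display_postulate)+

text \<open>This rests on closedness: whatever is orthogonal to all of \<open>cons_fml F\<close>
  already lies in \<open>ante_fml F\<close>. Premises of logical rules can thus be read as
  inclusions.\<close>

lemma valid_right_formula: "valid (X \<turnstile> \<langle>F\<rangle>) \<longleftrightarrow> ante X \<subseteq> ante_fml F"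
  by (auto simp: ante_fml_iff)

lemma valid_left_formula: "valid (\<langle>F\<rangle> \<turnstile> Y) \<longleftrightarrow> cons Y \<subseteq> cons_fml F"
  by (auto simp: cons_fml_iff)

lemma valid_rule:
  assumes "rule_instance r ps c" "\<forall>p\<in>set ps. valid p"
  shows "valid c"
  using assms
proof (induction rule: rule_instance.induct)
  \<comment> \<open>The cases below are, in this order, Cut, Display, NegL, MNegL, AndR, MAndR, ImpL, ImpR, MImpL,
    MImpR, CtrL and CtrR.\<close>
  case (2 X F Y)
  then show ?case
    \<comment> \<open>The first premise puts each member of \<open>ante X\<close> into
      \<open>ante_fml F\<close>, where the second premise applies.\<close>
    by (auto simp: ante_fml_iff)
next
  case (3 X' Y' X Y)
  then show ?case
    using valid_display_equiv by (metis list.set_intros(1))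
next
  case (12 F X)
  \<comment> \<open>Contrapose and cancel the double \<sharp>. An antecedent \<open>x\<close> of the
    negation thus yields a consequent \<open>\<sharp> x\<close> of \<open>F\<close>; the premise
    applied to it gives \<open>\<sharp> (\<sharp> x) \<turnstile> z\<close>, which displays to
    \<open>x \<turnstile> z\<close>.\<close>
  have "cut_free_provable (f \<turnstile> \<sharp> x) \<longleftrightarrow> cut_free_provable (x \<turnstile> \<sharp> f)" for f x
    using cut_free_provable_display(5,6) by metis
  with 12 have "\<sharp> x \<in> cons_fml F" if "x \<in> ante_fml (\<^bold>\<not> F)" for x
    using that by (auto simp: left_polar_def right_polar_def)
  with 12 show ?case
    using cut_free_provable_display(6) by fastforce
next
  case (14 F X)
  have "cut_free_provable (f \<turnstile> \<flat> x) \<longleftrightarrow> cut_free_provable (x \<turnstile> \<flat> f)" for f x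
    using cut_free_provable_display(11,12) by metis
  with 14 have "\<flat> x \<in> cons_fml F" if "x \<in> ante_fml (\<^bold>\<sim> F)" for x
    using that by (auto simp: left_polar_def right_polar_def)
  with 14 show ?case
    using cut_free_provable_display(12) by fastforce
next
  case (17 X F Y G)
  then have "ante X \<subseteq> ante_fml F" "ante Y \<subseteq> ante_fml G"
    by (simp_all add: valid_right_formula valid_left_formula del: valid.simps)
  \<comment> \<open>Members of \<open>ante X\<close> and \<open>ante Y\<close> combine to generators
    of the conjunction, and the triple polar identity reduces its consequent set to the right polar
    of these.\<close>
  then show ?case
    by (simp add: right_left_right_polar) (auto simp: right_polar_def)
next
  case (19 X F Y G)
  then have "ante X \<subseteq> ante_fml F" "ante Y \<subseteq> ante_fml G"
    by (simp_all add: valid_right_formula valid_left_formula del: valid.simps)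
  then show ?case
    by (simp add: right_left_right_polar) (auto simp: right_polar_def)
next
  case (24 X F G Y)
  then have "ante X \<subseteq> ante_fml F" "cons Y \<subseteq> cons_fml G"
    by (simp_all add: valid_right_formula valid_left_formula del: valid.simps)
  then show ?case
    by (auto simp: left_polar_def)
next
  case (25 X F G)
  \<comment> \<open>Displaying the premise moves the member of \<open>ante_fml F\<close> to the
    right, where it forms exactly the generators of the implication.\<close>
  then have "ante X \<subseteq> ante_fml (F \<^bold>\<rightarrow> G)"
    by (auto simp: left_polar_def cut_free_provable_display(1))
  then show ?case
    by (simp add: valid_right_formula del: valid.simps ante_fml.simps)
next
  case (26 X F G Y)
  then have "ante X \<subseteq> ante_fml F" "cons Y \<subseteq> cons_fml G"
    by (simp_all add: valid_right_formula valid_left_formula del: valid.simps)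
  then show ?case
    by (auto simp: left_polar_def)
next
  case (27 X F G)
  then have "ante X \<subseteq> ante_fml (F -\<^bold>* G)"
    by (auto simp: left_polar_def cut_free_provable_display(7))
  then show ?case
    by (simp add: valid_right_formula del: valid.simps ante_fml.simps)
next
  case (46 X Z)
  \<comment> \<open>Restricting the premise to diagonal pairs supplies the two equal copies that
    contraction asks for.\<close>
  then have "\<forall>x\<in>ante X. \<forall>z\<in>cons Z. cut_free_provable (x \<^bold>; x \<turnstile> z)"
    by auto
  then show ?case
    unfolding valid.simps using cut_free_provable_contraction(1) by blast
next
  case (47 X Z)
  then have "\<forall>x\<in>ante X. \<forall>z\<in>cons Z. cut_free_provable (x \<turnstile> z \<^bold>; z)"
    by auto
  then show ?case
    unfolding valid.simps using cut_free_provable_contraction(2) by blast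
\<comment> \<open>The remaining logical rules hold by unfolding the polars; associativity, unit and
  weakening rules act member by member.\<close>
qed (auto simp: right_left_right_polar left_polar_def right_polar_def cut_free_provable_bidirectional
      intro: cut_free_provable_weakening)

lemma valid_proof: "is_proof d \<Longrightarrow> valid (concl d)"
proof (induction d)
  case (Infer r ds c)
  then show ?case
    using valid_rule[of r "map concl ds" c] by auto
qed

theorem theorem3p8:
  fixes X Y :: cbi_structure
  assumes "provable (X \<turnstile> Y)"
  shows "cut_free_provable (X \<turnstile> Y)"
  using assms valid_proof valid_imp_cut_free_provable unfolding provable_def by metis

end
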